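(* For every nonnegative integer $n$, let $RR_2(n)$ denote the number of partitions of $n$ into parts greater than $1$ in which any two parts differ by at least $2$, and let $RR_{-2}(n)$ denote the number of signed partitions of $n$ in which the positive parts differ pairwise by at least $3$, alternate in parity (when listed in increasing order, consecutive positive parts have opposite parity), contain no part equal to $1$, and have odd smallest positive part, and the negative parts are distinct and each at most the number of positive parts. Then $RR_2(n)=RR_{-2}(n)$ for all $n\ge 0$.
   Context: A partition of an integer $n$ is a finite nonincreasing sequence of positive integers (its parts) summing to $n$. A signed partition of an integer $n$ is a pair $(\pi,\nu)$ of ordinary partitions with $|\pi|-|\nu|=n$, where $|\cdot|$ denotes the sum of parts; the parts of $\pi$ are the positive parts and the parts of $\nu$ are the negative parts (their sizes). *)

theory Defs
  imports Main
begin

definition is_partition :: "nat list \<Rightarrow> bool" where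
  "is_partition xs \<longleftrightarrow> sorted_wrt (\<ge>) xs \<and> (\<forall>x\<in>set xs. 0 < x)"

definition partitions :: "int \<Rightarrow> nat list set" where
  "partitions n = {xs. is_partition xs \<and> int (sum_list xs) = n}"

definition signed_partitions :: "int \<Rightarrow> (nat list \<times> nat list) set" where
  "signed_partitions n =
     {(\<pi>, \<nu>). is_partition \<pi> \<and> is_partition \<nu> \<and> int (sum_list \<pi>) - int (sum_list \<nu>) = n}"

text \<open>Parts are compared by position, so for \<open>d > 0\<close> repeated parts are excluded.\<close>
definition parts_differ_by_at_least :: "nat \<Rightarrow> nat list \<Rightarrow> bool" where
  "parts_differ_by_at_least d xs \<longleftrightarrow>
     (\<forall>i < length xs. \<forall>j < length xs. i \<noteq> j \<longrightarrow> int d \<le> \<bar>int (xs ! i) - int (xs ! j)\<bar>)"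

text \<open>Partitions are nonincreasing lists, so \<open>rev xs\<close> lists the parts in increasing order.\<close>
definition alternates_in_parity :: "nat list \<Rightarrow> bool" where
  "alternates_in_parity xs \<longleftrightarrow> successively (\<lambda>x y. even x \<noteq> even y) (rev xs)"

definition RR2_partitions :: "int \<Rightarrow> nat list set" where
  "RR2_partitions n =
     {xs \<in> partitions n. (\<forall>x\<in>set xs. 1 < x) \<and> parts_differ_by_at_least 2 xs}"

text \<open>The condition on the smallest positive part is vacuous if there are no positive parts.\<close>
definition RRm2_signed_partitions :: "int \<Rightarrow> (nat list \<times> nat list) set" where
  "RRm2_signed_partitions n =
     {(\<pi>, \<nu>) \<in> signed_partitions n.
        parts_differ_by_at_least 3 \<pi> \<and> alternates_in_parity \<pi> \<and> 1 \<notin> set \<pi> \<and>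
        (\<pi> \<noteq> [] \<longrightarrow> odd (Min (set \<pi>))) \<and>
        distinct \<nu> \<and> (\<forall>x\<in>set \<nu>. x \<le> length \<pi>)}"

definition RR2 :: "int \<Rightarrow> nat" where
  "RR2 n = card (RR2_partitions n)"

definition RRm2 :: "int \<Rightarrow> nat" where
  "RRm2 n = card (RRm2_signed_partitions n)"

text \<open>Both families are finite, so the cardinalities above are genuine counts.\<close>

lemma length_le_sum_list:
  "\<forall>x\<in>set xs. 0 < x \<Longrightarrow> length xs \<le> sum_list (xs :: nat list)"
  by (induction xs) auto

lemma finite_partitions: "finite (partitions n)"
proof (rule finite_subset)
  show "partitions n \<subseteq> {xs. set xs \<subseteq> {..nat n} \<and> length xs \<le> nat n}"
    using length_le_sum_list member_le_sum_list
    by (fastforce simp: partitions_def is_partition_def)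
qed (simp add: finite_lists_length_le)

lemma finite_RR2_partitions: "finite (RR2_partitions n)"
  by (rule finite_subset[OF _ finite_partitions[of n]]) (auto simp: RR2_partitions_def)

lemma sum_list_gaps:
  fixes xs :: "nat list"
  assumes "sorted_wrt (\<lambda>x y. y + 3 \<le> x) xs" and "\<forall>x\<in>set xs. 3 \<le> x"
  shows "3 * (length xs * (length xs + 1)) \<le> 2 * sum_list xs \<and> (xs \<noteq> [] \<longrightarrow> 3 * length xs \<le> hd xs)"
  using assms
proof (induction xs)
  case (Cons x xs)
  then have "3 * (length xs + 1) \<le> x"
    by (cases xs) auto
  with Cons show ?case
    by (auto simp: algebra_simps)
qed simp

lemma sum_list_distinct_le:
  fixes xs :: "nat list"
  assumes "distinct xs" and "\<forall>x\<in>set xs. x \<le> k"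
  shows "2 * sum_list xs \<le> k * (k + 1)"
proof -
  have "sum_list xs = \<Sum>(set xs)"
    using assms by (simp add: sum_list_distinct_conv_sum_set[of xs id, simplified])
  also have "\<dots> \<le> \<Sum>{0..k}"
    using assms by (intro sum_mono2) auto
  finally show ?thesis
    using gauss_sum_nat[of k] by simp
qed

lemma finite_RRm2_signed_partitions: "finite (RRm2_signed_partitions n)"
proof (rule finite_subset)
  let ?m = "nat n * (nat n + 1)"
  show "RRm2_signed_partitions n \<subseteq>
          (\<Union>a\<in>{0..n + int ?m}. partitions a) \<times> (\<Union>a\<in>{0..int ?m}. partitions a)"
  proof (rule subrelI)
    fix \<pi> \<nu> assume "(\<pi>, \<nu>) \<in> RRm2_signed_partitions n"
    then have part: "is_partition \<pi>" "is_partition \<nu>"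
      and n: "int (sum_list \<pi>) - int (sum_list \<nu>) = n"
      and gap: "parts_differ_by_at_least 3 \<pi>" and "1 \<notin> set \<pi>"
      and odd: "\<pi> \<noteq> [] \<longrightarrow> odd (Min (set \<pi>))"
      and neg: "distinct \<nu>" "\<forall>x\<in>set \<nu>. x \<le> length \<pi>"
      by (auto simp: RRm2_signed_partitions_def signed_partitions_def)
    let ?k = "length \<pi>"
    have "sorted_wrt (\<lambda>x y. y + 3 \<le> x) \<pi>"
      unfolding sorted_wrt_iff_nth_less
    proof (intro allI impI)
      fix i j assume ij: "i < j" "j < length \<pi>"
      have "\<pi> ! j \<le> \<pi> ! i"
        using part(1) ij by (auto simp: is_partition_def sorted_wrt_iff_nth_less)
      moreover have "int 3 \<le> \<bar>int (\<pi> ! i) - int (\<pi> ! j)\<bar>"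
        using gap ij unfolding parts_differ_by_at_least_def by auto
      ultimately show "\<pi> ! j + 3 \<le> \<pi> ! i" by linarith
    qed
    moreover have "\<forall>x\<in>set \<pi>. 3 \<le> x"
    proof
      fix x assume x: "x \<in> set \<pi>"
      then have "\<pi> \<noteq> []" by auto
      then have "Min (set \<pi>) \<in> set \<pi>" and "odd (Min (set \<pi>))"
        using odd by auto
      moreover have "Min (set \<pi>) \<noteq> 1"
        using \<open>1 \<notin> set \<pi>\<close> calculation(1) by metis
      ultimately have "3 \<le> Min (set \<pi>)" by presburger
      then show "3 \<le> x" using x by (meson List.finite_set Min_le order_trans)
    qed
    ultimately have "3 * (?k * (?k + 1)) \<le> 2 * sum_list \<pi>"
      using sum_list_gaps by blast
    moreover have nu: "2 * sum_list \<nu> \<le> ?k * (?k + 1)"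
      using neg by (rule sum_list_distinct_le)
    ultimately have "int (?k * (?k + 1)) \<le> n"
      using n by linarith
    then have "?k * (?k + 1) \<le> nat n" by linarith
    then have "sum_list \<nu> \<le> ?m"
      using nu by (simp add: algebra_simps)
    then show "(\<pi>, \<nu>) \<in> (\<Union>a\<in>{0..n + int ?m}. partitions a) \<times> (\<Union>a\<in>{0..int ?m}. partitions a)"
      using part n by (auto simp: partitions_def simp del: of_nat_mult of_nat_add)
  qed
qed (auto intro: finite_partitions)

end

theory Submission
  imports Defs
begin

text \<open>Encode a nonincreasing list \<open>x\<^sub>1 \<ge> \<dots> \<ge> x\<^sub>k\<close> by its gaps \<open>d\<^sub>i = x\<^sub>i - x\<^bsub>i+1\<^esub>\<close>, with
  \<open>x\<^bsub>k+1\<^esub> = 0\<close>; its sum is then \<open>\<Sum>i. i * d\<^sub>i\<close>. The partitions counted by \<open>RR2\<close> are those with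
  all gaps at least 2, and the positive parts of those counted by \<open>RRm2\<close> are those with all gaps
  odd and at least 3. Raising every even gap \<open>d\<^sub>i\<close> by one adds \<open>i\<close> to the sum, which is
  compensated by a negative part \<open>i\<close>; since the negative parts record which gaps were even, this
  is a bijection.\<close>

fun partition_of_gaps :: "nat list \<Rightarrow> nat list" where
  "partition_of_gaps [] = []"
| "partition_of_gaps (d # ds) = sum_list (d # ds) # partition_of_gaps ds"

lemma length_partition_of_gaps [simp]: "length (partition_of_gaps ds) = length ds"
  by (induction ds) auto

lemma partition_of_gaps_eq_Nil_iff [simp]: "partition_of_gaps ds = [] \<longleftrightarrow> ds = []"
  by (cases ds) auto

lemma hd_partition_of_gaps: "ds \<noteq> [] \<Longrightarrow> hd (partition_of_gaps ds) = sum_list ds"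
  by (cases ds) auto

lemma partition_of_gaps_le_sum_list: "x \<in> set (partition_of_gaps ds) \<Longrightarrow> x \<le> sum_list ds"
  by (induction ds) auto

lemma partition_of_gaps_inject: "partition_of_gaps ds = partition_of_gaps es \<longleftrightarrow> ds = es"
proof (induction ds arbitrary: es)
  case Nil
  show ?case by (cases es) auto
next
  case (Cons d ds)
  show ?case using Cons.IH[of "tl es"] by (cases es) auto
qed

text \<open>The first part is the first gap plus the next part, so sortedness makes the subtraction
  that recovers the gap exact.\<close>

lemma ex_partition_of_gaps: "sorted_wrt (\<ge>) xs \<Longrightarrow> \<exists>ds. xs = partition_of_gaps ds"
proof (induction xs)
  case Nil
  show ?case by (rule exI[of _ "[]"]) simp
next
  case (Cons x xs)
  then obtain ds where ds: "xs = partition_of_gaps ds" by auto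
  have "sum_list ds \<le> x"
    using Cons.prems ds by (cases ds) auto
  then show ?case
    using ds by (intro exI[of _ "(x - sum_list ds) # ds"]) simp
qed

text \<open>The gap at index \<open>i\<close> is a summand of exactly the first \<open>Suc i\<close>
  parts.\<close>

lemma sum_list_partition_of_gaps:
  "sum_list (partition_of_gaps ds) = (\<Sum>i<length ds. Suc i * ds ! i)"
proof (induction ds)
  case (Cons d ds)
  have "(\<Sum>i<length (d # ds). Suc i * (d # ds) ! i)
      = d + (\<Sum>i<length ds. Suc (Suc i) * ds ! i)"
    by (simp add: sum.lessThan_Suc_shift del: sum.lessThan_Suc)
  also have "\<dots> = d + (\<Sum>i<length ds. ds ! i) + (\<Sum>i<length ds. Suc i * ds ! i)"
    by (simp add: sum.distrib)
  also have "(\<Sum>i<length ds. ds ! i) = sum_list ds"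
    by (simp add: sum_list_sum_nth atLeast0LessThan)
  finally show ?case
    using Cons by simp
qed simp

section \<open>Conditions on parts in terms of gaps\<close>

text \<open>A difference of two parts is a sum of the gaps between them, so adjacent parts decide.
  The last gap is the smallest part itself, which is why the lower bound on the parts is
  included.\<close>

lemma sorted_partition_of_gaps_iff:
  "sorted_wrt (\<lambda>x y. y + c \<le> x) (partition_of_gaps ds) \<and> (\<forall>x\<in>set (partition_of_gaps ds). c \<le> x)
    \<longleftrightarrow> (\<forall>d\<in>set ds. c \<le> d)"
proof (induction ds)
  case (Cons d ds)
  have "(\<forall>y\<in>set (partition_of_gaps ds). y + c \<le> d + sum_list ds) \<and> c \<le> d + sum_list ds \<longleftrightarrow> c \<le> d"
  proof
    assume "(\<forall>y\<in>set (partition_of_gaps ds). y + c \<le> d + sum_list ds) \<and> c \<le> d + sum_list ds"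
    \<comment> \<open>For nonempty \<open>ds\<close> the next part \<open>sum_list ds\<close> forces
      the bound; for empty \<open>ds\<close> the second conjunct does.\<close>
    then show "c \<le> d" by (cases ds) auto
  qed (auto dest: partition_of_gaps_le_sum_list)
  with Cons show ?case by auto
qed simp

lemma sorted_partition_of_gaps: "sorted_wrt (\<ge>) (partition_of_gaps ds)"
  using sorted_partition_of_gaps_iff[of 0 ds] by simp

lemma parts_differ_by_at_least_iff_sorted_wrt:
  assumes "sorted_wrt (\<ge>) xs"
  shows "parts_differ_by_at_least c xs \<longleftrightarrow> sorted_wrt (\<lambda>x y. y + c \<le> x) xs"
proof
  assume gap: "parts_differ_by_at_least c xs"
  show "sorted_wrt (\<lambda>x y. y + c \<le> x) xs"
    unfolding sorted_wrt_iff_nth_less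
  proof (intro allI impI)
    fix i j assume ij: "i < j" "j < length xs"
    have "xs ! j \<le> xs ! i"
      using assms ij by (auto simp: sorted_wrt_iff_nth_less)
    moreover have "int c \<le> \<bar>int (xs ! i) - int (xs ! j)\<bar>"
      using gap ij unfolding parts_differ_by_at_least_def by auto
    ultimately show "xs ! j + c \<le> xs ! i" by linarith
  qed
next
  assume "sorted_wrt (\<lambda>x y. y + c \<le> x) xs"
  then have sep: "xs ! j + c \<le> xs ! i" if "i < j" "j < length xs" for i j
    using that by (auto simp: sorted_wrt_iff_nth_less)
  show "parts_differ_by_at_least c xs"
    unfolding parts_differ_by_at_least_def
  proof (intro allI impI)
    fix i j assume "i < length xs" "j < length xs" "i \<noteq> j"
    then show "int c \<le> \<bar>int (xs ! i) - int (xs ! j)\<bar>"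
      using sep[of i j] sep[of j i] by (cases "i < j") auto
  qed
qed

lemma Min_set_partition_of_gaps: "ds \<noteq> [] \<Longrightarrow> Min (set (partition_of_gaps ds)) = last ds"
proof (induction ds)
  case (Cons d ds)
  show ?case
  proof (cases "ds = []")
    case False
    then have "Min (set (partition_of_gaps (d # ds))) = min (d + sum_list ds) (last ds)"
      using Cons by simp
    moreover have "last ds \<le> sum_list ds"
      using False by (simp add: member_le_sum_list)
    ultimately show ?thesis using False by simp
  qed simp
qed simp

text \<open>Adjacent parts differ by a gap, so alternation means that all gaps but the last are odd;
  the condition on the last gap, which is the smallest part, completes this.\<close>

lemma alternates_in_parity_partition_of_gaps_iff:
  "alternates_in_parity (partition_of_gaps ds) \<and> (ds \<noteq> [] \<longrightarrow> odd (last ds))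
    \<longleftrightarrow> (\<forall>d\<in>set ds. odd d)"
proof (induction ds)
  case Nil
  then show ?case by (simp add: alternates_in_parity_def)
next
  case (Cons d ds)
  show ?case
  proof (cases "ds = []")
    case True
    then show ?thesis by (simp add: alternates_in_parity_def)
  next
    case False
    then have "alternates_in_parity (partition_of_gaps (d # ds)) \<longleftrightarrow>
        alternates_in_parity (partition_of_gaps ds) \<and> odd d"
      by (auto simp: alternates_in_parity_def successively_append_iff last_rev hd_partition_of_gaps)
    with False Cons show ?thesis by auto
  qed
qed

section \<open>The two families in terms of gaps\<close>

lemma RR2_partitions_eq:
  "RR2_partitions n = partition_of_gaps `
     {ds. (\<forall>d\<in>set ds. 2 \<le> d) \<and> int (sum_list (partition_of_gaps ds)) = n}"
proof -
  have "partition_of_gaps ds \<in> RR2_partitions n \<longleftrightarrow>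
      (\<forall>d\<in>set ds. 2 \<le> d) \<and> int (sum_list (partition_of_gaps ds)) = n" for ds
  proof -
    have "(\<forall>x\<in>set xs. 0 < x) \<and> (\<forall>x\<in>set xs. 1 < x) \<longleftrightarrow> (\<forall>x\<in>set xs. 2 \<le> x)" for xs :: "nat list"
      by (auto simp: numeral_2_eq_2 Suc_le_eq intro: Suc_lessD)
    then show ?thesis
      unfolding sorted_partition_of_gaps_iff[of 2 ds, symmetric] RR2_partitions_def partitions_def
        is_partition_def mem_Collect_eq
        parts_differ_by_at_least_iff_sorted_wrt[OF sorted_partition_of_gaps]
      using sorted_partition_of_gaps[of ds] by blast
  qed
  moreover have "xs \<in> RR2_partitions n \<Longrightarrow> \<exists>ds. xs = partition_of_gaps ds" for xs
    by (rule ex_partition_of_gaps) (simp add: RR2_partitions_def partitions_def is_partition_def)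
  ultimately show ?thesis by blast
qed

lemma partition_of_gaps_in_RRm2_iff:
  "(partition_of_gaps es, \<nu>) \<in> RRm2_signed_partitions n \<longleftrightarrow>
     (\<forall>e\<in>set es. odd e \<and> 3 \<le> e) \<and> sorted_wrt (>) \<nu> \<and> set \<nu> \<subseteq> {1..length es} \<and>
     int (sum_list (partition_of_gaps es)) - int (sum_list \<nu>) = n"
proof -
  let ?p = "partition_of_gaps es"
  \<comment> \<open>Oddness makes the smallest part odd, so excluding 1 lifts it to 3. Without
    oddness the single part 2 would satisfy the left side only.\<close>
  have ge3: "(\<forall>x\<in>set ?p. 0 < x) \<and> 1 \<notin> set ?p \<and> parts_differ_by_at_least 3 ?p
      \<longleftrightarrow> (\<forall>e\<in>set es. 3 \<le> e)" if odd: "\<forall>e\<in>set es. odd e"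
  proof -
    have "(\<forall>x\<in>set ?p. 0 < x) \<and> 1 \<notin> set ?p \<longleftrightarrow> (\<forall>x\<in>set ?p. 3 \<le> x)"
    proof (cases "es = []")
      case False
      then have "odd (Min (set ?p))"
        using odd by (simp add: Min_set_partition_of_gaps)
      moreover have Min: "Min (set ?p) \<in> set ?p"
        using False by (intro Min_in) simp_all
      ultimately have "3 \<le> Min (set ?p)" if "1 \<notin> set ?p"
      proof -
        have "Min (set ?p) \<noteq> 1" using that Min by metis
        with \<open>odd (Min (set ?p))\<close> show ?thesis by presburger
      qed
      then have "3 \<le> x" if "1 \<notin> set ?p" "x \<in> set ?p" for x
        using that by (meson List.finite_set Min_le order_trans)
      then show ?thesis by fastforce
    qed simp
    then show ?thesis
      using sorted_partition_of_gaps_iff[of 3 es]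
      by (auto simp: parts_differ_by_at_least_iff_sorted_wrt sorted_partition_of_gaps)
  qed
  have "sorted_wrt (\<ge>) \<nu> \<and> distinct \<nu> \<longleftrightarrow> sorted_wrt (>) \<nu>"
    by (induction \<nu>) (auto simp: order_less_le)
  moreover have "(\<forall>x\<in>set \<nu>. 0 < x) \<and> (\<forall>x\<in>set \<nu>. x \<le> length es) \<longleftrightarrow> set \<nu> \<subseteq> {1..length es}"
    by (auto simp: Suc_le_eq)
  moreover have "alternates_in_parity ?p \<and> (?p \<noteq> [] \<longrightarrow> odd (Min (set ?p))) \<longleftrightarrow> (\<forall>e\<in>set es. odd e)"
    using alternates_in_parity_partition_of_gaps_iff[of es]
    by (cases "es = []") (simp_all add: Min_set_partition_of_gaps)
  ultimately show ?thesis
    using ge3 sorted_partition_of_gaps[of es]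
    unfolding RRm2_signed_partitions_def signed_partitions_def is_partition_def by auto
qed

section \<open>The bijection\<close>

definition round_up_odd :: "nat \<Rightarrow> nat" where
  "round_up_odd d = (if even d then Suc d else d)"

text \<open>Positions count from 1, so that each equals the weight of its gap in
  \<open>sum_list_partition_of_gaps\<close> and can serve as a negative part.\<close>

definition even_positions :: "nat list \<Rightarrow> nat set" where
  "even_positions ds = {Suc i |i. i < length ds \<and> even (ds ! i)}"

definition signed_of_gaps :: "nat list \<Rightarrow> nat list \<times> nat list" where
  "signed_of_gaps ds =
     (partition_of_gaps (map round_up_odd ds), rev (sorted_list_of_set (even_positions ds)))"

lemma finite_even_positions [simp]: "finite (even_positions ds)"
  by (simp add: even_positions_def)

lemma Suc_in_even_positions_iff [simp]:
  "Suc i \<in> even_positions ds \<longleftrightarrow> i < length ds \<and> even (ds ! i)"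
  by (auto simp: even_positions_def)

lemma even_positions_subset: "even_positions ds \<subseteq> {1..length ds}"
  by (auto simp: even_positions_def)

lemma sum_list_round_up_odd:
  "sum_list (partition_of_gaps (map round_up_odd ds)) =
     sum_list (partition_of_gaps ds) + \<Sum>(even_positions ds)"
proof -
  have "\<Sum>(even_positions ds) = (\<Sum>i | i < length ds \<and> even (ds ! i). Suc i)"
    unfolding even_positions_def by (subst sum.reindex[symmetric, unfolded o_def])
      (auto intro!: sum.cong)
  also have "\<dots> = (\<Sum>i<length ds. if even (ds ! i) then Suc i else 0)"
    by (simp add: sum.If_cases Int_def)
  finally show ?thesis
    unfolding sum_list_partition_of_gaps
    by (auto simp: round_up_odd_def sum.distrib[symmetric] intro!: sum.cong)
qed

lemma sum_list_sorted_list_of_set: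
  "finite A \<Longrightarrow> sum_list (sorted_list_of_set A) = \<Sum>(A :: nat set)"
  using sum_list_distinct_conv_sum_set[of "sorted_list_of_set A" id] by simp

text \<open>Rounding identifies only an even number with its successor, and the recorded positions
  tell these apart.\<close>

lemma inj_signed_of_gaps: "inj signed_of_gaps"
proof (rule injI)
  fix ds es assume "signed_of_gaps ds = signed_of_gaps es"
  then have odd: "map round_up_odd ds = map round_up_odd es"
    and "sorted_list_of_set (even_positions ds) = sorted_list_of_set (even_positions es)"
    by (auto simp: signed_of_gaps_def partition_of_gaps_inject)
  then have pos: "even_positions ds = even_positions es"
    by (metis finite_even_positions sorted_list_of_set.set_sorted_key_list_of_set)
  have len: "length ds = length es"
    using odd by (rule map_eq_imp_length_eq)
  show "ds = es"
  proof (rule nth_equalityI[OF len])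
    fix i assume i: "i < length ds"
    have "round_up_odd (ds ! i) = round_up_odd (es ! i)"
      using odd i len by (metis nth_map)
    moreover have "even (ds ! i) \<longleftrightarrow> even (es ! i)"
      using pos i len Suc_in_even_positions_iff by metis
    ultimately show "ds ! i = es ! i"
      by (auto simp: round_up_odd_def split: if_splits)
  qed
qed

text \<open>Rounding sends 0 and 1 to 1 and everything from 2 on to at least 3; the surplus in the
  sum cancels against the negative parts.\<close>

lemma signed_of_gaps_in_RRm2_iff:
  "signed_of_gaps ds \<in> RRm2_signed_partitions n \<longleftrightarrow>
     (\<forall>d\<in>set ds. 2 \<le> d) \<and> int (sum_list (partition_of_gaps ds)) = n"
proof -
  have "odd (round_up_odd d) \<and> 3 \<le> round_up_odd d \<longleftrightarrow> 2 \<le> d" for d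
    unfolding round_up_odd_def by presburger
  then show ?thesis
    using even_positions_subset[of ds]
    by (auto simp: signed_of_gaps_def partition_of_gaps_in_RRm2_iff sum_list_round_up_odd
        sum_list_sorted_list_of_set sorted_wrt_rev)
qed

lemma RRm2_subset_range_signed_of_gaps: "RRm2_signed_partitions n \<subseteq> range signed_of_gaps"
proof (rule subrelI)
  fix \<pi> \<nu> assume mem: "(\<pi>, \<nu>) \<in> RRm2_signed_partitions n"
  then obtain es where es: "\<pi> = partition_of_gaps es"
    using ex_partition_of_gaps[of \<pi>]
    by (auto simp: RRm2_signed_partitions_def signed_partitions_def is_partition_def)
  with mem have odd: "\<forall>e\<in>set es. odd e \<and> 3 \<le> e"
    and neg: "sorted_wrt (>) \<nu>" "set \<nu> \<subseteq> {1..length es}"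
    by (auto simp: partition_of_gaps_in_RRm2_iff)
  \<comment> \<open>The preimage lowers the gaps whose positions occur in \<open>\<nu>\<close>.
    These gaps are odd and at least 3, so the subtraction is exact and the result even.\<close>
  define ds where
    "ds = map (\<lambda>i. if Suc i \<in> set \<nu> then es ! i - 1 else es ! i) [0..<length es]"
  have len: "length ds = length es" by (simp add: ds_def)
  have even_iff: "even (ds ! i) \<longleftrightarrow> Suc i \<in> set \<nu>" if "i < length es" for i
    using that odd by (auto simp: ds_def dest!: nth_mem)
  have "map round_up_odd ds = es"
  proof (rule nth_equalityI)
    fix i assume "i < length (map round_up_odd ds)"
    then have i: "i < length es" by (simp add: len)
    then have "odd (es ! i)" "3 \<le> es ! i" using odd by auto
    then show "map round_up_odd ds ! i = es ! i"
      using i by (auto simp: ds_def round_up_odd_def)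
  qed (simp add: len)
  \<comment> \<open>The bound on the negative parts by the number of positive parts makes each of
    them the position of a gap.\<close>
  moreover have "even_positions ds = set \<nu>"
  proof (rule set_eqI)
    fix x show "x \<in> even_positions ds \<longleftrightarrow> x \<in> set \<nu>"
      using neg(2) even_iff len even_positions_subset[of ds]
      by (cases x) (auto simp: Suc_le_eq)
  qed
  moreover have "rev (sorted_list_of_set (set \<nu>)) = \<nu>"
  proof -
    have "sorted_wrt (<) (rev \<nu>)" using neg(1) by (simp add: sorted_wrt_rev)
    then have "sorted_list_of_set (set (rev \<nu>)) = rev \<nu>"
      by (intro sorted_list_of_set.idem_if_sorted_distinct) (simp_all add: strict_sorted_iff)
    then show ?thesis by simp
  qed
  ultimately have "signed_of_gaps ds = (\<pi>, \<nu>)"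
    by (simp add: signed_of_gaps_def es)
  then show "(\<pi>, \<nu>) \<in> range signed_of_gaps" by (metis rangeI)
qed

theorem theorem3p2:
  fixes n :: nat
  shows "RR2 (int n) = RRm2 (int n)"
proof -
  let ?G = "{ds. (\<forall>d\<in>set ds. 2 \<le> d) \<and> int (sum_list (partition_of_gaps ds)) = int n}"
  \<comment> \<open>The range inclusion supplies a gap list for each signed partition, and the
    membership equivalence places it in \<open>?G\<close>.\<close>
  have "RRm2_signed_partitions (int n) = signed_of_gaps ` ?G"
    using RRm2_subset_range_signed_of_gaps[of "int n"] signed_of_gaps_in_RRm2_iff[of _ "int n"]
    by blast
  then have "RRm2 (int n) = card ?G"
    unfolding RRm2_def using inj_signed_of_gaps by (simp add: card_image inj_on_def)
  moreover have "RR2 (int n) = card ?G"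
    unfolding RR2_def RR2_partitions_eq
    by (rule card_image) (simp add: inj_on_def partition_of_gaps_inject)
  ultimately show ?thesis by simp
qed

end
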